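(* For every $n\geq 2$, the total number of runs in all the members of $\mathcal{R}_n$ is $$\sum_{\pi\in\mathcal{R}_n}\mathrm{run}(\pi)=B_n-(n-1)B_{n-2}.$$
   Context: Permutations $\pi=\pi_1\cdots\pi_n$ of $[n]=\{1,\ldots,n\}$ are written in one-line notation. A run of $\pi$ is a maximal increasing sequence of consecutive entries; $\mathrm{run}(\pi)$ is the number of runs. A permutation is run-sorted if $\pi_1=1$ and the first entries of its runs, read from left to right, form an increasing sequence. $\mathcal{R}_n$ denotes the set of run-sorted permutations of $[n]$. $B_n$ denotes the $n$-th Bell number, i.e., the number of set partitions of $[n]$ ($B_0=1$). *)

theory Defs
  imports Main "HOL-Library.Disjoint_Sets" "HOL-Combinatorics.Multiset_Permutations"
begin

text \<open>Permutations of \<open>{1..n}\<close> in one-line notation are the lists in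
  \<^term>\<open>permutations_of_set {1..n}\<close>; list positions are counted from 0.\<close>

definition increasing_block :: "nat list \<Rightarrow> nat \<times> nat \<Rightarrow> bool" where
  "increasing_block xs = (\<lambda>(i, j). i \<le> j \<and> j < length xs \<and> strict_mono_on {i..j} (\<lambda>k. xs ! k))"

text \<open>A run is represented by the pair of its first and last position.\<close>

definition runs :: "nat list \<Rightarrow> (nat \<times> nat) set" where
  "runs xs = {(i, j). increasing_block xs (i, j) \<and>
     (\<forall>i' j'. increasing_block xs (i', j') \<and> {i..j} \<subseteq> {i'..j'} \<longrightarrow> (i', j') = (i, j))}"

definition run :: "nat list \<Rightarrow> nat" where
  "run xs = card (runs xs)"

definition run_sorted :: "nat list \<Rightarrow> bool" where
  "run_sorted xs \<longleftrightarrow> xs \<noteq> [] \<and> hd xs = 1 \<and>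
     (\<forall>(i, j) \<in> runs xs. \<forall>(i', j') \<in> runs xs. i < i' \<longrightarrow> xs ! i < xs ! i')"

definition run_sorted_perms :: "nat \<Rightarrow> nat list set" where
  "run_sorted_perms n = {\<pi> \<in> permutations_of_set {1..n}. run_sorted \<pi>}"

definition Bell :: "nat \<Rightarrow> nat" where
  "Bell n = card {P. partition_on {1..n} P}"

end

theory Submission 
  imports Defs
begin

text \<open>
  A run-sorted permutation of \<open>{1..n}\<close> has the form \<open>1 # xs\<close>, and these lists \<open>xs\<close> correspond to the
  set partitions of \<open>{2..n}\<close>: list the blocks by increasing minimum, write each block as its
  remaining elements in increasing order followed by its minimum, and concatenate. For example,
  the partition \<open>{2,5}, {3}, {4,6,7}\<close> gives \<open>1 5 2 3 6 7 4\<close>. Two properties make this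
  work. First, the block minima are the entries that are smaller than everything after them, so
  the list determines the partition. Second, inside a block the only descent is the final step
  down to the minimum, and between blocks there is no descent at all, because a minimum is smaller
  than every later entry. So every run after the first starts at a block minimum, and these minima
  increase. Conversely, in a run-sorted permutation the first entry of a run is smaller than all
  later entries, so the stretch between two such right-to-left minima cannot contain a descent
  except into the second of them.

  A block produces a descent exactly when it is not a singleton, so the number of runs of the
  permutation is one plus the number of non-singleton blocks (\<open>run_eq_descents\<close>,
  \<open>card_non_singleton_blocks\<close>, \<open>bij_betw_blocks\<close>).

  It remains to sum, over the partitions \<open>P\<close> of the set \<open>{2..n}\<close> of size \<open>n - 1\<close>, the quantity
  \<open>1 + |P|\<close> minus the number of singletons in \<open>P\<close>. The sum of \<open>1 + |P|\<close> is the Bell number of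
  \<open>n\<close>, since \<open>1 + |P|\<close> counts the ways to insert one new element into \<open>P\<close>, either into a block or as
  a new block (\<open>sum_Suc_card_partitions\<close>). The total number of singletons is \<open>n - 1\<close> times the Bell
  number of \<open>n - 2\<close>, since each of the \<open>n - 1\<close> elements is a singleton in as many partitions as
  the other \<open>n - 2\<close> elements have (\<open>sum_singleton_blocks\<close>).
\<close>

section \<open>Runs and descents\<close>

definition run_starts :: "nat list \<Rightarrow> nat set" where
  "run_starts xs = {i. i < length xs \<and> (i = 0 \<or> \<not> xs ! (i - 1) < xs ! i)}"

fun descents :: "'a::linorder list \<Rightarrow> nat" where
  "descents (x # y # ys) = (if y < x then 1 else 0) + descents (y # ys)"
| "descents _ = 0"

text \<open>
  The list form of run-sortedness: every entry reached by a descent is smaller than all later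
  entries. The condition that the first entry be 1 is kept separate.
\<close>

fun drops_to_minima :: "'a::linorder list \<Rightarrow> bool" where
  "drops_to_minima (x # y # ys) \<longleftrightarrow> (y < x \<longrightarrow> (\<forall>z\<in>set ys. y < z)) \<and> drops_to_minima (y # ys)"
| "drops_to_minima _ \<longleftrightarrow> True"

lemma increasing_block_iff:
  "increasing_block xs (i, j) \<longleftrightarrow> i \<le> j \<and> j < length xs \<and> (\<forall>k. i \<le> k \<and> k < j \<longrightarrow> xs ! k < xs ! Suc k)"
proof -
  have "strict_mono_on {i..j} (\<lambda>k. xs ! k)" if step: "\<forall>k. i \<le> k \<and> k < j \<longrightarrow> xs ! k < xs ! Suc k"
  proof (rule strict_mono_onI)
    fix r s assume "r \<in> {i..j}" "s \<in> {i..j}" "r < s"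
    then have "Suc r \<le> s" "i \<le> r" "s \<le> j" by auto
    then show "xs ! r < xs ! s"
    proof (induction s rule: dec_induct)
      case base then show ?case using step by auto
    next
      case (step n)
      then have "xs ! r < xs ! n" "xs ! n < xs ! Suc n"
        using that by auto
      then show ?case by simp
    qed
  qed
  moreover have "xs ! k < xs ! Suc k"
    if "strict_mono_on {i..j} (\<lambda>k. xs ! k)" "i \<le> k" "k < j" for k
    using strict_mono_onD[OF that(1), of k "Suc k"] that by simp
  ultimately show ?thesis
    unfolding increasing_block_def by blast
qed

lemma increasing_block_extend_left:
  assumes "increasing_block xs (i, j)" "0 < i" "xs ! (i - 1) < xs ! i"
  shows "increasing_block xs (i - 1, j)"
proof (cases i)
  case (Suc m)
  have "xs ! k < xs ! Suc k" if "m \<le> k" "k < j" for k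
    using that assms Suc by (cases "k = m") (auto simp: increasing_block_iff)
  then show ?thesis using assms Suc by (auto simp: increasing_block_iff)
qed (use assms in simp)

text \<open>
  Maximality is local: a block that can be enlarged at all can be enlarged by one position, to the
  left or to the right.
\<close>

lemma runs_iff:
  "(i, j) \<in> runs xs \<longleftrightarrow> increasing_block xs (i, j) \<and> i \<in> run_starts xs
     \<and> (Suc j = length xs \<or> \<not> xs ! j < xs ! Suc j)" (is "?L \<longleftrightarrow> ?R")
proof
  assume L: ?L
  then have blk: "increasing_block xs (i, j)"
    and mx: "\<And>i' j'. increasing_block xs (i', j') \<Longrightarrow> {i..j} \<subseteq> {i'..j'} \<Longrightarrow> (i', j') = (i, j)"
    unfolding runs_def by auto
  have "i = 0 \<or> \<not> xs ! (i - 1) < xs ! i"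
  proof (rule ccontr)
    assume a: "\<not> (i = 0 \<or> \<not> xs ! (i - 1) < xs ! i)"
    then have "increasing_block xs (i - 1, j)"
      using blk by (intro increasing_block_extend_left) auto
    then show False using mx[of "i - 1" j] a by auto
  qed
  moreover have "Suc j = length xs \<or> \<not> xs ! j < xs ! Suc j"
  proof (rule ccontr)
    assume a: "\<not> (Suc j = length xs \<or> \<not> xs ! j < xs ! Suc j)"
    then have "increasing_block xs (i, Suc j)"
      using blk unfolding increasing_block_iff by (auto simp: less_Suc_eq)
    then show False using mx[of i "Suc j"] by auto
  qed
  ultimately show ?R
    using blk unfolding run_starts_def increasing_block_iff by auto
next
  assume R: ?R
  have "(i', j') = (i, j)" if b: "increasing_block xs (i', j')" and s: "{i..j} \<subseteq> {i'..j'}" for i' j'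
  proof -
    have ij: "i \<le> j" using R by (simp add: increasing_block_iff)
    then have "i' \<le> i" "j \<le> j'" using s by auto
    moreover have "\<not> i' < i"
    proof
      assume "i' < i"
      then have "xs ! (i - 1) < xs ! Suc (i - 1)"
        using b \<open>j \<le> j'\<close> ij unfolding increasing_block_iff by (cases i) auto
      then show False using R \<open>i' < i\<close> by (auto simp: run_starts_def)
    qed
    moreover have "\<not> j < j'"
      using b R ij \<open>i' \<le> i\<close> unfolding increasing_block_iff by auto
    ultimately show ?thesis by auto
  qed
  then show ?L using R unfolding runs_def by blast
qed

lemma bij_betw_runs_run_starts: "bij_betw fst (runs xs) (run_starts xs)"
  unfolding bij_betw_def
proof
  have "j = j'" if "(i, j) \<in> runs xs" "(i, j') \<in> runs xs" for i j j'
    using that unfolding runs_iff increasing_block_iff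
    by (metis Suc_leI linorder_neqE_nat not_less)
  then show "inj_on fst (runs xs)"
    by (auto simp: inj_on_def)
  show "fst ` runs xs = run_starts xs"
  proof (intro equalityI subsetI)
    fix i assume "i \<in> fst ` runs xs"
    then show "i \<in> run_starts xs" using runs_iff by auto
  next
    fix i assume i: "i \<in> run_starts xs"
    define J where "J = {j. increasing_block xs (i, j)}"
    have fin: "finite J"
      unfolding J_def increasing_block_iff by (rule finite_subset[of _ "{..<length xs}"]) auto
    have "i \<in> J" using i unfolding J_def increasing_block_iff run_starts_def by auto
    then have M: "Max J \<in> J" using fin Max_in by blast
    have "Suc (Max J) \<notin> J" using Max_ge[OF fin, of "Suc (Max J)"] by auto
    then have "Suc (Max J) = length xs \<or> \<not> xs ! Max J < xs ! Suc (Max J)"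
      using M unfolding J_def increasing_block_iff by (auto simp: less_Suc_eq)
    then have "(i, Max J) \<in> runs xs"
      using M i unfolding runs_iff J_def by auto
    then show "i \<in> fst ` runs xs" by force
  qed
qed

lemma run_start_below:
  assumes "k < length xs"
  obtains i where "i \<in> run_starts xs" "increasing_block xs (i, k)"
proof -
  define i where "i = (LEAST i. increasing_block xs (i, k))"
  have "increasing_block xs (k, k)" using assms by (simp add: increasing_block_iff)
  then have blk: "increasing_block xs (i, k)" unfolding i_def by (rule LeastI)
  have "i = 0 \<or> \<not> xs ! (i - 1) < xs ! i"
  proof (rule ccontr)
    assume a: "\<not> (i = 0 \<or> \<not> xs ! (i - 1) < xs ! i)"
    then have "increasing_block xs (i - 1, k)"
      using blk by (intro increasing_block_extend_left) auto
    then have "i \<le> i - 1" unfolding i_def by (rule Least_le)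
    then show False using a by auto
  qed
  then have "i \<in> run_starts xs"
    using blk by (auto simp: run_starts_def increasing_block_iff)
  then show ?thesis using blk that by blast
qed

text \<open>
  Asking for the first entry of a run to be smaller than the first entries of the later runs is the
  same as asking for it to be smaller than all later entries, because each of those lies in the same
  run or in a later one and is at least the first entry of that run.
\<close>

lemma run_starts_increasing_iff:
  "(\<forall>(i, j) \<in> runs xs. \<forall>(i', j') \<in> runs xs. i < i' \<longrightarrow> xs ! i < xs ! i') \<longleftrightarrow>
   (\<forall>i \<in> run_starts xs. \<forall>j. i < j \<and> j < length xs \<longrightarrow> xs ! i < xs ! j)" (is "?L \<longleftrightarrow> ?R")
proof -
  have img: "run_starts xs = fst ` runs xs"
    using bij_betw_runs_run_starts[of xs] by (simp add: bij_betw_def)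
  have "?L \<longleftrightarrow> (\<forall>i \<in> run_starts xs. \<forall>i' \<in> run_starts xs. i < i' \<longrightarrow> xs ! i < xs ! i')" (is "_ \<longleftrightarrow> ?M")
    unfolding img by fastforce
  also have "?M \<longleftrightarrow> ?R"
  proof
    assume M: ?M
    show ?R
    proof (intro ballI allI impI)
      fix i j assume i: "i \<in> run_starts xs" and j: "i < j \<and> j < length xs"
      obtain i' where i': "i' \<in> run_starts xs" and blk: "increasing_block xs (i', j)"
        using run_start_below j by blast
      have mono: "xs ! k < xs ! l" if "i' \<le> k" "k < l" "l \<le> j" for k l
        using strict_mono_onD[of "{i'..j}" "\<lambda>k. xs ! k" k l] blk that
        unfolding increasing_block_def by auto
      consider "i' \<le> i" | "i < i'" by linarith
      then show "xs ! i < xs ! j"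
      proof cases
        case 1 then show ?thesis using mono[of i j] j by auto
      next
        case 2
        then have "xs ! i < xs ! i'" using M i i' by blast
        moreover have "i' = j \<or> xs ! i' < xs ! j"
          using mono[of i' j] blk by (cases "i' = j") (auto simp: increasing_block_iff)
        ultimately show ?thesis by auto
      qed
    qed
  next
    assume ?R then show ?M by (auto simp: run_starts_def)
  qed
  finally show ?thesis .
qed

text \<open>
  In a list without repetitions a step that is not an ascent is a descent, so apart from position 0
  the runs start right after the descents.
\<close>

lemma run_starts_Cons:
  assumes "distinct (x # xs)"
  shows "run_starts (x # xs) = insert 0 (Suc ` {i. i < length xs \<and> xs ! i < (x # xs) ! i})"
proof -
  have "\<not> (x # xs) ! i < xs ! i \<longleftrightarrow> xs ! i < (x # xs) ! i" if "i < length xs" for i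
    using nth_eq_iff_index_eq[OF assms, of i "Suc i"] that by auto
  then have "k \<in> run_starts (x # xs) \<longleftrightarrow>
      k \<in> insert 0 (Suc ` {i. i < length xs \<and> xs ! i < (x # xs) ! i})" for k
    unfolding run_starts_def by (cases k) auto
  then show ?thesis by blast
qed

lemma descents_eq_card: "descents (x # xs) = card {i. i < length xs \<and> xs ! i < (x # xs) ! i}"
proof (induction xs arbitrary: x)
  case Nil then show ?case by simp
next
  case (Cons y ys)
  let ?D = "{i. i < length ys \<and> ys ! i < (y # ys) ! i}"
  have "k \<in> {i. i < length (y # ys) \<and> (y # ys) ! i < (x # y # ys) ! i} \<longleftrightarrow>
      k \<in> (if y < x then {0} else {}) \<union> Suc ` ?D" for k
    by (cases k) auto
  then have "{i. i < length (y # ys) \<and> (y # ys) ! i < (x # y # ys) ! i} =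
      (if y < x then {0} else {}) \<union> Suc ` ?D"
    by blast
  then show ?case using Cons by (auto simp: card_image)
qed

lemma drops_to_minima_iff:
  "drops_to_minima (x # xs) \<longleftrightarrow>
     (\<forall>i < length xs. xs ! i < (x # xs) ! i \<longrightarrow> (\<forall>j. i < j \<and> j < length xs \<longrightarrow> xs ! i < xs ! j))"
proof (induction xs arbitrary: x)
  case Nil then show ?case by simp
next
  case (Cons y ys)
  have *: "(\<forall>j. Suc i < j \<and> j < length (y # ys) \<longrightarrow> ys ! i < (y # ys) ! j) \<longleftrightarrow>
        (\<forall>j. i < j \<and> j < length ys \<longrightarrow> ys ! i < ys ! j)" for i
    by (auto simp: nth_Cons split: nat.splits)
  have **: "(\<forall>z\<in>set ys. y < z) \<longleftrightarrow> (\<forall>j. 0 < j \<and> j < length (y # ys) \<longrightarrow> y < (y # ys) ! j)"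
    by (auto simp: all_set_conv_all_nth nth_Cons split: nat.splits)
  show ?case
    unfolding drops_to_minima.simps Cons ** using * by (simp add: All_less_Suc2)
qed

lemma run_eq_descents:
  assumes "distinct (x # xs)"
  shows "run (x # xs) = 1 + descents (x # xs)"
proof -
  have "run (x # xs) = card (run_starts (x # xs))"
    unfolding run_def using bij_betw_runs_run_starts by (rule bij_betw_same_card)
  then show ?thesis
    unfolding run_starts_Cons[OF assms] by (simp add: card_image descents_eq_card)
qed

lemma run_sorted_iff:
  assumes "distinct (1 # xs)" "\<forall>x\<in>set xs. 1 < x"
  shows "run_sorted (1 # xs) \<longleftrightarrow> drops_to_minima (1 # xs)"
proof -
  have sh: "(\<forall>j. Suc i < j \<and> j < length (1 # xs) \<longrightarrow> (1 # xs) ! Suc i < (1 # xs) ! j) \<longleftrightarrow>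
        (\<forall>j. i < j \<and> j < length xs \<longrightarrow> xs ! i < xs ! j)" for i
    by (auto simp: nth_Cons split: nat.splits)
  have z: "(\<forall>j. 0 < j \<and> j < length (1 # xs) \<longrightarrow> (1 # xs) ! 0 < (1 # xs) ! j)"
    using assms(2) by (auto simp: nth_Cons split: nat.splits)
  show ?thesis
    unfolding run_sorted_def run_starts_increasing_iff run_starts_Cons[OF assms(1)]
      drops_to_minima_iff using z sh by auto
qed


section \<open>Lists whose descents lead to minima, and set partitions\<close>

text \<open>
  The prefix of the list that ends at its minimum is the first block; the remaining entries are
  decomposed in the same way. The result is the partition whose blocks, ordered by their minima and
  written with the minimum last, concatenate to the list.
\<close>

function blocks :: "'a::linorder list \<Rightarrow> 'a set set" where
  "blocks xs = (if xs = [] then {}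
     else let m = Min (set xs) in
       insert (insert m (set (takeWhile (\<lambda>x. x \<noteq> m) xs))) (blocks (tl (dropWhile (\<lambda>x. x \<noteq> m) xs))))"
  by pat_completeness auto
termination
proof (relation "measure length", simp)
  fix xs :: "'a list" and m assume "xs \<noteq> []" "m = Min (set xs)"
  then have "dropWhile (\<lambda>x. x \<noteq> m) xs \<noteq> []" by (simp add: dropWhile_eq_Nil_conv)
  then show "(tl (dropWhile (\<lambda>x. x \<noteq> m) xs), xs) \<in> measure length"
    using length_dropWhile_le[of "\<lambda>x. x \<noteq> m" xs] by (cases "dropWhile (\<lambda>x. x \<noteq> m) xs") auto
qed

\<comment> \<open>The defining equation has no constructor pattern and would rewrite forever.\<close>
declare blocks.simps [simp del]

lemma blocks_Nil [simp]: "blocks [] = {}"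
  by (simp add: blocks.simps)

lemma blocks_split_Min:
  assumes "\<forall>x\<in>set s. m < x" "\<forall>x\<in>set w. m < x"
  shows "blocks (s @ m # w) = insert (insert m (set s)) (blocks w)"
proof -
  have "Min (set (s @ m # w)) = m"
    using assms by (intro Min_eqI) (auto intro: less_imp_le)
  moreover have "takeWhile (\<lambda>x. x \<noteq> m) (s @ m # w) = s" "dropWhile (\<lambda>x. x \<noteq> m) (s @ m # w) = m # w"
    using assms by (auto simp: takeWhile_append dropWhile_append)
  ultimately show ?thesis
    by (subst blocks.simps) (simp only: Let_def, simp)
qed

text \<open>The induction principle that follows the recursion of \<^const>\<open>blocks\<close>.\<close>

lemma split_Min_induct [consumes 1, case_names Nil split]:
  fixes xs :: "'a::linorder list"
  assumes "distinct xs"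
    and Nil: "P []"
    and split: "\<And>s m w. \<lbrakk>distinct (s @ m # w); \<forall>x\<in>set s. m < x; \<forall>x\<in>set w. m < x; P w\<rbrakk> \<Longrightarrow> P (s @ m # w)"
  shows "P xs"
  using assms(1)
proof (induction xs rule: length_induct)
  case (1 xs)
  show ?case
  proof (cases "xs = []")
    case False
    define m where "m = Min (set xs)"
    have "m \<in> set xs" using False by (simp add: m_def)
    then obtain s w where xs: "xs = s @ m # w" by (meson split_list)
    have "m \<le> x" if "x \<in> set xs" for x using that by (simp add: m_def)
    then have "\<forall>x\<in>set s. m < x" "\<forall>x\<in>set w. m < x"
      using 1(2) unfolding xs by (force simp: less_le)+
    then show ?thesis
      using 1 split unfolding xs by simp
  qed (use Nil in simp)
qed

lemma drops_to_minima_Cons_Min: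
  "\<forall>x\<in>set w. m < x \<Longrightarrow> drops_to_minima (m # w) \<longleftrightarrow> drops_to_minima w"
  by (cases w) auto

lemma descents_Cons_Min:
  "\<forall>x\<in>set w. m < x \<Longrightarrow> descents (m # w) = descents w"
  by (cases w) auto

text \<open>
  A descent inside \<open>s\<close> would lead to an entry larger than the later entry \<open>m\<close>, so \<open>s\<close> has to be
  sorted; the step from \<open>s\<close> to \<open>m\<close> is always allowed.
\<close>

lemma drops_to_minima_split_Min:
  assumes "\<forall>x\<in>set s. m < x" "\<forall>x\<in>set w. m < x"
  shows "drops_to_minima (s @ m # w) \<longleftrightarrow> sorted s \<and> drops_to_minima w"
  using assms
proof (induction s rule: induct_list012)
  case (3 x y s)
  then have "drops_to_minima ((x # y # s) @ m # w) \<longleftrightarrow> x \<le> y \<and> sorted (y # s) \<and> drops_to_minima w"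
    by (auto simp: not_less)
  then show ?case by (simp add: sorted2 del: sorted_wrt.simps)
qed (auto simp: drops_to_minima_Cons_Min)

lemma descents_split_Min:
  assumes "sorted s" "\<forall>x\<in>set s. m < x" "\<forall>x\<in>set w. m < x"
  shows "descents (s @ m # w) = (if s = [] then 0 else 1) + descents w"
  using assms by (induction s rule: induct_list012) (auto simp: descents_Cons_Min)

lemma partition_on_remove:
  assumes "partition_on A P" "B \<in> P"
  shows "partition_on (A - B) (P - {B})" "B \<subseteq> A"
proof -
  have "disjnt B (\<Union>(P - {B}))"
    using assms(2) partition_onD2[OF assms(1)] unfolding disjnt_def disjoint_def by blast
  then show "partition_on (A - B) (P - {B})" "B \<subseteq> A"
    using partition_on_insert[of B "P - {B}" A] assms by (auto simp: insert_absorb)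
qed

lemma partition_on_blocks: "distinct xs \<Longrightarrow> partition_on (set xs) (blocks xs)"
proof (induction xs rule: split_Min_induct)
  case Nil then show ?case by (simp add: partition_on_empty)
next
  case (split s m w)
  have "\<Union>(blocks w) = set w" using split(4) partition_onD1 by blast
  then have "disjnt (insert m (set s)) (\<Union>(blocks w))"
    using split(1) by (auto simp: disjnt_iff)
  moreover have "set (s @ m # w) - insert m (set s) = set w" using split(1) by auto
  ultimately show ?case
    using split by (auto simp: blocks_split_Min partition_on_insert)
qed

text \<open>
  The only descent within a block is the step down to its minimum, which exists unless the block
  is a singleton; the step from a minimum to the next block is an ascent.
\<close>

lemma card_non_singleton_blocks:
  assumes "distinct xs" "drops_to_minima xs"
  shows "card {B \<in> blocks xs. card B \<noteq> 1} = descents xs"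
  using assms
proof (induction xs rule: split_Min_induct)
  case Nil then show ?case by simp
next
  case (split s m w)
  let ?N = "{B \<in> blocks w. card B \<noteq> 1}"
  have part: "partition_on (set w) (blocks w)" using split(1) by (simp add: partition_on_blocks)
  have srt: "sorted s" "drops_to_minima w"
    using split drops_to_minima_split_Min by blast+
  have "m \<notin> \<Union>(blocks w)" using split(1) partition_onD1[OF part] by auto
  then have "insert m (set s) \<notin> ?N" by blast
  moreover have "finite ?N" using finite_elements[OF _ part] by simp
  moreover have "card (insert m (set s)) = 1 \<longleftrightarrow> s = []"
    using split(1) by (auto simp: card_insert_if)
  moreover have "{B \<in> blocks (s @ m # w). card B \<noteq> 1} =
      (if card (insert m (set s)) = 1 then ?N else insert (insert m (set s)) ?N)"
    using split by (auto simp: blocks_split_Min)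
  ultimately show ?case
    using split srt by (auto simp: descents_split_Min)
qed

text \<open>
  The block that contains the minimum \<open>m\<close> determines the sorted prefix before \<open>m\<close>, and the other
  blocks determine the rest of the list.
\<close>

lemma blocks_inject:
  assumes "distinct xs" "drops_to_minima xs" "distinct ys" "drops_to_minima ys" "blocks xs = blocks ys"
  shows "xs = ys"
  using assms
proof (induction xs arbitrary: ys rule: split_Min_induct)
  case Nil
  then have "set ys = {}" using partition_onD1[OF partition_on_blocks[of ys]] by simp
  then show ?case by simp
next
  case (split s m w)
  have sets: "set ys = set (s @ m # w)"
    using split(1,6,8) partition_onD1 partition_on_blocks by metis
  then obtain s' w' where ys: "ys = s' @ m # w'" by (metis in_set_conv_decomp)
  have lt: "\<forall>x\<in>set s'. m < x" "\<forall>x\<in>set w'. m < x"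
    using split(1,2,3,6) sets unfolding ys by (auto; blast)+
  have eq: "insert (insert m (set s)) (blocks w) = insert (insert m (set s')) (blocks w')"
    using split(8) blocks_split_Min[OF split(2,3)] blocks_split_Min[OF lt] by (simp add: ys)
  have U: "\<Union>(blocks w) = set w" "\<Union>(blocks w') = set w'"
    using partition_onD1[OF partition_on_blocks] split(1,6) by (auto simp: ys)
  have "m \<notin> set w" "m \<notin> set w'" using lt split(3) by auto
  then have no: "B \<notin> blocks w" "B \<notin> blocks w'" if "m \<in> B" for B
    using that U by auto
  have "insert m (set s) = insert m (set s')"
    using eq no[of "insert m (set s)"] by blast
  moreover have "m \<notin> set s" "m \<notin> set s'" using lt split(2) by auto
  ultimately have ss: "set s = set s'" by (simp add: insert_ident)
  moreover have "sorted s" "sorted s'"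
    using split(5,7) drops_to_minima_split_Min[OF split(2,3)] drops_to_minima_split_Min[OF lt] by (auto simp: ys)
  ultimately have "s = s'" using split(1,6) by (intro sorted_distinct_set_unique) (auto simp: ys)
  moreover have "blocks w = blocks w'"
    using eq no ss by (metis insertI1 insert_ident)
  then have "w = w'"
    using split drops_to_minima_split_Min[OF split(2,3)] drops_to_minima_split_Min[OF lt] by (auto simp: ys)
  ultimately show ?case by (simp add: ys)
qed

lemma blocks_surj:
  assumes "finite A" "partition_on A P"
  shows "\<exists>xs. set xs = A \<and> distinct xs \<and> drops_to_minima xs \<and> blocks xs = P"
  using assms
proof (induction A arbitrary: P rule: finite_psubset_induct)
  case (psubset A)
  show ?case
  proof (cases "A = {}")
    case True
    then show ?thesis using psubset by (auto simp: partition_on_empty)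
  next
    case False
    define m where "m = Min A"
    have mA: "m \<in> A" using False psubset by (simp add: m_def)
    then obtain B where B: "B \<in> P" "m \<in> B" using partition_onD1[OF psubset(3)] by blast
    have "partition_on (A - B) (P - {B})" and BA: "B \<subseteq> A"
      using partition_on_remove[OF psubset(3) B(1)] by auto
    moreover have "A - B \<subset> A" using B mA by auto
    ultimately obtain w where w: "set w = A - B" "distinct w" "drops_to_minima w" "blocks w = P - {B}"
      using psubset.IH by metis
    define s where "s = sorted_list_of_set (B - {m})"
    have fB: "finite B" using BA psubset finite_subset by blast
    then have s: "set s = B - {m}" "sorted s" "distinct s" by (auto simp: s_def)
    have "m \<le> x" if "x \<in> A" for x using that psubset(1) by (simp add: m_def)
    then have lt: "\<forall>x\<in>set s. m < x" "\<forall>x\<in>set w. m < x"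
      using BA B by (auto simp: s w less_le)
    have "blocks (s @ m # w) = P"
      using B by (auto simp: blocks_split_Min[OF lt] s w insert_absorb)
    moreover have "set (s @ m # w) = A" using B BA by (auto simp: s w)
    moreover have "distinct (s @ m # w)" using B s w by auto
    moreover have "drops_to_minima (s @ m # w)"
      using drops_to_minima_split_Min[OF lt] s w by simp
    ultimately show ?thesis by blast
  qed
qed

lemma bij_betw_blocks:
  assumes "finite A"
  shows "bij_betw blocks {xs. set xs = A \<and> distinct xs \<and> drops_to_minima xs} {P. partition_on A P}"
  unfolding bij_betw_def
proof
  show "inj_on blocks {xs. set xs = A \<and> distinct xs \<and> drops_to_minima xs}"
    by (auto intro!: inj_onI blocks_inject)
  show "blocks ` {xs. set xs = A \<and> distinct xs \<and> drops_to_minima xs} = {P. partition_on A P}"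
    using partition_on_blocks blocks_surj[OF assms] by (fastforce simp: image_iff)
qed

section \<open>Counting set partitions\<close>

text \<open>
  \<^const>\<open>Bell\<close> counts partitions of an initial segment only; transport along an injection in both
  directions shows that the count depends on the cardinality alone.
\<close>

lemma card_partitions_le:
  assumes "finite B" "inj_on f A" "f ` A = B"
  shows "card {P. partition_on A P} \<le> card {P. partition_on B P}"
proof (rule card_inj_on_le)
  show "inj_on (\<lambda>P. (`) f ` P - {{}}) {P. partition_on A P}"
  proof (rule inj_onI)
    fix P Q
    assume PQ: "P \<in> {P. partition_on A P}" "Q \<in> {P. partition_on A P}"
      and eq: "(`) f ` P - {{}} = (`) f ` Q - {{}}"
    have "{} \<notin> (`) f ` P" "{} \<notin> (`) f ` Q" using PQ by (auto dest: partition_onD3)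
    with eq have "(`) f ` P = (`) f ` Q" by simp
    moreover have "inj_on ((`) ((`) f)) (Pow (Pow A))"
      using assms(2) by (intro inj_on_image_Pow)
    moreover have "P \<in> Pow (Pow A)" "Q \<in> Pow (Pow A)" using PQ by (auto dest: partition_onD1)
    ultimately show "P = Q" by (meson inj_onD)
  qed
  show "(\<lambda>P. (`) f ` P - {{}}) ` {P. partition_on A P} \<subseteq> {P. partition_on B P}"
    using partition_on_inj_image[OF _ assms(2)] assms(3) by auto
  show "finite {P. partition_on B P}" using assms(1) by (rule finitely_many_partition_on)
qed

lemma card_partitions_eq:
  assumes "finite A" "card A = n"
  shows "card {P. partition_on A P} = Bell n"
proof -
  obtain f where f: "bij_betw f A {1..n}"
    using finite_same_card_bij[OF assms(1), of "{1..n}"] assms(2) by auto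
  then have "bij_betw (inv_into A f) {1..n} A" by (rule bij_betw_inv_into)
  then show ?thesis
    unfolding Bell_def using f assms(1)
    by (intro antisym card_partitions_le) (auto simp: bij_betw_def)
qed

text \<open>
  A partition of \<open>insert x A\<close> arises in exactly one way by adding \<open>x\<close> to a block of a partition
  \<open>P\<close> of \<open>A\<close> or by making it a new block. The second case is adding \<open>x\<close> to the empty set, which is
  not a block of \<open>P\<close>, so both cases are covered by a choice from \<open>insert {} P\<close>.
\<close>

lemma sum_Suc_card_partitions:
  assumes "finite A" "x \<notin> A"
  shows "(\<Sum>P | partition_on A P. Suc (card P)) = card {Q. partition_on (insert x A) Q}"
proof -
  let ?S = "SIGMA P:{P. partition_on A P}. insert {} P"
  let ?f = "\<lambda>(P, B). insert (insert x B) (P - {B})"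
  have sub: "x \<notin> C" if "partition_on A P" "C \<in> insert {} P" for P C
    using that assms(2) partition_onD1 by fastforce
  have inj: "inj_on ?f ?S"
  proof (rule inj_onI, clarify)
    fix P B P' B'
    assume P: "partition_on A P" "partition_on A P'" and B: "B \<in> insert {} P" "B' \<in> insert {} P'"
      and eq: "insert (insert x B) (P - {B}) = insert (insert x B') (P' - {B'})"
    have x: "x \<notin> C" if "C \<in> P \<or> C \<in> P' \<or> C = {}" for C
      using that sub[OF P(1)] sub[OF P(2)] by blast
    have "insert x B \<in> insert (insert x B') (P' - {B'})" using eq by blast
    then have "insert x B = insert x B'" using x[of "insert x B"] by blast
    moreover have "x \<notin> B" "x \<notin> B'" using x B by blast+
    ultimately have BB: "B = B'" by (simp add: insert_ident)
    have "insert x B \<notin> P - {B}" "insert x B \<notin> P' - {B}" using x[of "insert x B"] by blast+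
    then have "P - {B} = P' - {B}" using eq unfolding BB by (simp add: insert_ident)
    moreover have "B \<in> P \<longleftrightarrow> B \<noteq> {}" "B \<in> P' \<longleftrightarrow> B \<noteq> {}"
      using B BB partition_onD3[OF P(1)] partition_onD3[OF P(2)] by auto
    ultimately show "P = P' \<and> B = B'" using BB by blast
  qed
  have into: "partition_on (insert x A) (insert (insert x B) (P - {B}))"
    if P: "partition_on A P" and B: "B \<in> insert {} P" for P B
  proof -
    have "partition_on (A - B) (P - {B}) \<and> B \<subseteq> A"
      using partition_on_remove[OF P] partition_onD3[OF P] P B by (cases "B = {}") auto
    moreover have "insert x A - insert x B = A - B" using assms(2) by blast
    moreover have "disjnt (insert x B) (\<Union>(P - {B}))"
      using calculation(1) partition_onD1[of "A - B"] assms(2) by (auto simp: disjnt_iff)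
    ultimately show ?thesis by (auto simp: partition_on_insert)
  qed
  \<comment> \<open>Removing \<open>x\<close> from its block leaves a block of the preimage, unless \<open>x\<close> was a singleton.\<close>
  have onto: "Q \<in> ?f ` ?S" if Q: "partition_on (insert x A) Q" for Q
  proof -
    obtain C where C: "C \<in> Q" "x \<in> C" using partition_onD1[OF Q] by blast
    define B where "B = C - {x}"
    define P where "P = (if B = {} then Q - {C} else insert B (Q - {C}))"
    have CB: "C = insert x B" using C by (auto simp: B_def)
    have rem: "partition_on (insert x A - C) (Q - {C})" "C \<subseteq> insert x A"
      using partition_on_remove[OF Q C(1)] by auto
    moreover have "insert x A - C = A - B" "B \<subseteq> A" using assms(2) rem(2) C(2) by (auto simp: B_def)
    ultimately have rem': "partition_on (A - B) (Q - {C})" by simp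
    then have un: "\<Union>(Q - {C}) = A - B" using partition_onD1 by metis
    have "disjnt B (\<Union>(Q - {C}))" unfolding un by (auto simp: disjnt_iff)
    then have "partition_on A P"
      using rem' \<open>B \<subseteq> A\<close> by (auto simp: P_def partition_on_insert)
    moreover have "B \<in> insert {} P" by (simp add: P_def)
    moreover have "B \<notin> Q - {C}"
    proof
      assume "B \<in> Q - {C}"
      then have "B = {}" using un by blast
      then show False using \<open>B \<in> Q - {C}\<close> partition_onD3[OF Q] by blast
    qed
    then have "Q = insert (insert x B) (P - {B})"
      using C(1) by (auto simp: P_def CB)
    ultimately show ?thesis by force
  qed
  have "bij_betw ?f ?S {Q. partition_on (insert x A) Q}"
  proof (rule bij_betw_imageI[OF inj], intro equalityI subsetI)
    fix Q assume "Q \<in> ?f ` ?S"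
    then show "Q \<in> {Q. partition_on (insert x A) Q}" using into by (auto simp del: insert_iff)
  next
    fix Q assume "Q \<in> {Q. partition_on (insert x A) Q}"
    then show "Q \<in> ?f ` ?S" by (intro onto) simp
  qed
  then have "card ?S = card {Q. partition_on (insert x A) Q}" by (rule bij_betw_same_card)
  moreover have "card ?S = (\<Sum>P | partition_on A P. card (insert {} P))"
    using assms finite_elements by (intro card_SigmaI finitely_many_partition_on) auto
  moreover have "card (insert {} P) = Suc (card P)" if "partition_on A P" for P
    using finite_elements[OF assms(1) that] partition_onD3[OF that] by simp
  ultimately show ?thesis by simp
qed

lemma card_partitions_with_singleton:
  assumes "x \<in> A"
  shows "card {P. partition_on A P \<and> {x} \<in> P} = card {P. partition_on (A - {x}) P}"
proof -
  have dj: "disjnt {x} (\<Union>P)" if "partition_on (A - {x}) P" for P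
    using partition_onD1[OF that] by (auto simp: disjnt_iff)
  have "bij_betw (insert {x}) {P. partition_on (A - {x}) P} {P. partition_on A P \<and> {x} \<in> P}"
  proof (rule bij_betw_byWitness[where f' = "\<lambda>P. P - {{x}}"])
    show "\<forall>P\<in>{P. partition_on (A - {x}) P}. insert {x} P - {{x}} = P"
      using dj by auto
    show "\<forall>P\<in>{P. partition_on A P \<and> {x} \<in> P}. insert {x} (P - {{x}}) = P" by auto
    show "insert {x} ` {P. partition_on (A - {x}) P} \<subseteq> {P. partition_on A P \<and> {x} \<in> P}"
      using dj assms by (auto simp: partition_on_insert)
    show "(\<lambda>P. P - {{x}}) ` {P. partition_on A P \<and> {x} \<in> P} \<subseteq> {P. partition_on (A - {x}) P}"
      using partition_on_remove(1) by auto
  qed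
  then show ?thesis by (simp add: bij_betw_same_card)
qed

text \<open>Double counting of the pairs of an element and a partition in which it is a singleton.\<close>

lemma sum_singleton_blocks:
  assumes "finite A"
  shows "(\<Sum>P | partition_on A P. card {B \<in> P. card B = 1}) = card A * Bell (card A - 1)"
proof -
  have fin: "finite {P. partition_on A P}" using assms by (rule finitely_many_partition_on)
  have "card {B \<in> P. card B = 1} = card {x \<in> A. {x} \<in> P}" if "partition_on A P" for P
  proof -
    have "{B \<in> P. card B = 1} = (\<lambda>x. {x}) ` {x \<in> A. {x} \<in> P}"
      using partition_onD1[OF that] by (auto simp: card_1_singleton_iff)
    then show ?thesis by (simp add: card_image)
  qed
  then have "(\<Sum>P | partition_on A P. card {B \<in> P. card B = 1}) = (\<Sum>P | partition_on A P. card {x \<in> A. {x} \<in> P})"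
    by simp
  also have "\<dots> = (\<Sum>x\<in>A. card {P. partition_on A P \<and> {x} \<in> P})"
    using sum_multicount_gen[of A "{P. partition_on A P}" "\<lambda>x P. {x} \<in> P"] assms fin
    by (simp add: sum_multicount_gen)
  also have "\<dots> = (\<Sum>x\<in>A. Bell (card A - 1))"
    using assms by (intro sum.cong refl) (simp add: card_partitions_with_singleton card_partitions_eq)
  finally show ?thesis by simp
qed

section \<open>Run-sorted permutations\<close>

lemma run_sorted_perms_eq:
  assumes "n \<ge> 1"
  shows "run_sorted_perms n = (#) 1 ` {xs. set xs = {2..n} \<and> distinct xs \<and> drops_to_minima xs}"
proof (rule set_eqI)
  fix \<pi> :: "nat list"
  have perm: "1 # xs \<in> permutations_of_set {1..n} \<longleftrightarrow> set xs = {2..n} \<and> distinct xs" for xs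
  proof -
    have "{1..n} = insert 1 {2..n}" using assms by auto
    then show ?thesis unfolding permutations_of_set_def by (auto simp: insert_ident)
  qed
  have sorted: "run_sorted (1 # xs) \<longleftrightarrow> drops_to_minima xs" if "set xs = {2..n}" "distinct xs" for xs
    using that by (subst run_sorted_iff) (auto simp: drops_to_minima_Cons_Min)
  show "\<pi> \<in> run_sorted_perms n \<longleftrightarrow> \<pi> \<in> (#) 1 ` {xs. set xs = {2..n} \<and> distinct xs \<and> drops_to_minima xs}"
  proof (cases "\<exists>xs. \<pi> = 1 # xs")
    case True
    then show ?thesis using perm sorted by (auto simp: run_sorted_perms_def)
  next
    case False
    then have "\<not> run_sorted \<pi>" unfolding run_sorted_def by (metis list.collapse)
    then show ?thesis using False by (auto simp: run_sorted_perms_def)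
  qed
qed

theorem proposition2p2:
  fixes n :: nat
  assumes "n \<ge> 2"
  shows "int (\<Sum>\<pi>\<in>run_sorted_perms n. run \<pi>) = int (Bell n) - (int n - 1) * int (Bell (n - 2))"
proof -
  let ?A = "{2..n}"
  let ?W = "{xs. set xs = ?A \<and> distinct xs \<and> drops_to_minima xs}"
  have "(\<Sum>\<pi>\<in>run_sorted_perms n. run \<pi>) = (\<Sum>xs\<in>?W. run (1 # xs))"
    using assms by (simp add: run_sorted_perms_eq sum.reindex)
  also have "\<dots> = (\<Sum>xs\<in>?W. Suc (card {B \<in> blocks xs. card B \<noteq> 1}))"
    by (intro sum.cong refl)
      (auto simp: run_eq_descents descents_Cons_Min card_non_singleton_blocks simp del: One_nat_def)
  also have "\<dots> = (\<Sum>P | partition_on ?A P. Suc (card {B \<in> P. card B \<noteq> 1}))"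
    by (rule sum.reindex_bij_betw[OF bij_betw_blocks]) simp
  finally have runs: "(\<Sum>\<pi>\<in>run_sorted_perms n. run \<pi>) =
      (\<Sum>P | partition_on ?A P. Suc (card {B \<in> P. card B \<noteq> 1}))" .
  have singletons: "(\<Sum>P | partition_on ?A P. card {B \<in> P. card B = 1}) = (n - 1) * Bell (n - 2)"
    using sum_singleton_blocks[of ?A] by (simp add: numeral_2_eq_2)
  have "card {B \<in> P. card B \<noteq> 1} + card {B \<in> P. card B = 1} = card P" if "partition_on ?A P" for P
  proof -
    have "finite P" using that finite_elements by blast
    then have "card ({B \<in> P. card B \<noteq> 1} \<union> {B \<in> P. card B = 1}) =
        card {B \<in> P. card B \<noteq> 1} + card {B \<in> P. card B = 1}"
      by (intro card_Un_disjoint) auto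
    moreover have "{B \<in> P. card B \<noteq> 1} \<union> {B \<in> P. card B = 1} = P" by auto
    ultimately show ?thesis by simp
  qed
  then have "(\<Sum>P | partition_on ?A P. Suc (card {B \<in> P. card B \<noteq> 1})) +
      (\<Sum>P | partition_on ?A P. card {B \<in> P. card B = 1}) = (\<Sum>P | partition_on ?A P. Suc (card P))"
    by (simp add: sum.distrib[symmetric])
  also have "\<dots> = Bell n"
    using sum_Suc_card_partitions[of ?A 1] assms by (simp add: card_partitions_eq)
  finally have "(\<Sum>\<pi>\<in>run_sorted_perms n. run \<pi>) + (n - 1) * Bell (n - 2) = Bell n"
    unfolding runs singletons .
  then have "int (\<Sum>\<pi>\<in>run_sorted_perms n. run \<pi>) + int (n - 1) * int (Bell (n - 2)) = int (Bell n)"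
    by (metis of_nat_add of_nat_mult)
  moreover have "int (n - 1) = int n - 1" using assms by simp
  ultimately show ?thesis by simp
qed

end
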